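(* There is a constant $C>0$, depending only on the parameters of the backtracking line search, such that the following holds. Starting from a $d(d+1)$-dimensional vector $\widehat{W}^1$, the algorithm MEMIP constructs a sequence of $K$ estimates $(\widehat{X}^1,\dots,\widehat{X}^K)$ satisfying, for any $k\in\{1,\dots,K\}$, $$\Big|\widehat{\mathcal{L}}^k(\widehat{X}^k,\mathcal{H})-\sup_X\widehat{\mathcal{L}}^k(X,\mathcal{H})\Big|\le\epsilon ,$$ in at most $$C\Big(\sup_X\widehat{\mathcal{L}}^K(X,\mathcal{H})-\widehat{\mathcal{L}}^1(\widehat{W}^1,\mathcal{H})\Big)+K\big(\log_2\log_2(1/\epsilon)+C\epsilon\big)$$ Newton iterations.
   Context: Data. $\mathcal{H}$ is a data set of $n$ i.i.d. realizations of a $d$-dimensional Hawkes process, that is, a $d$-dimensional counting process whose $u$-th component has rate of occurrence $\lambda_u(t)=\big(\mu_u(t)+\sum_{v=1}^d\sum_{t_v<t}g_{uv}(t-t_v)\big)_+$, where $\mu_u$ is a background rate, $g_{uv}$ is a triggering kernel (possibly taking negative values), $t_v$ runs over the times of events of type $v$, and $(\cdot)_+$ is the positive part. A realization $h\in\mathcal{H}$ consists of an observation period $[T_h^-,T_h^+]$ (with $\min_h T_h^-=0$, without loss of generality) and the events $(t_i^h,u_i^h)$, $i=1,\dots,n_h$, occurring during it, where $t_i^h$ is the time and $u_i^h\in\{1,\dots,d\}$ the type of the $i$-th event. Objective functions. Let $\alpha>0$ be the mapping parameter and $K$ the maximal polynomial degree. For $k\in\{1,\dots,K\}$ let $X=(X_{uv,j})$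 with $u\in\{1,\dots,d\}$, $v\in\{0,1,\dots,d\}$, $j\in\{1,\dots,k\}$, so that $X\in\mathbb{R}^{d(d+1)k}$ ($u$ is the affected type, $v\ge1$ the triggering type, $v=0$ the background). Define the linear form $$\Lambda^{k,h}_u(s;X)=\sum_{j=1}^k X_{u0,j}\,e^{-j\alpha s}+\sum_{v=1}^d\sum_{j=1}^k X_{uv,j}\sum_{i:\,t_i^h<s,\ u_i^h=v}e^{-(j+1)\alpha(s-t_i^h)}$$ and the relaxed approximate log-likelihood (the approximate log-likelihood in which the positive part of the rate is dropped) $$\widehat{\mathcal{L}}^k(X,\mathcal{H})=\sum_{h\in\mathcal{H}}\sum_{i=1}^{n_h}\ln\big(\Lambda^{k,h}_{u_i^h}(t_i^h;X)\big)-\sum_{h\in\mathcal{H}}\sum_{u=1}^d\int_{T_h^-}^{T_h^+}\Lambda^{k,h}_u(s;X)\,ds ,$$ with $\ln(x)=-\infty$ for $x\le0$. Suprema $\sup_X\widehat{\mathcal{L}}^k(X,\mathcal{H})$ are over $X\in\mathbb{R}^{d(d+1)k}$. The number $\epsilon$ is the precision to be reached in each Newton maximization. Newton maximization. $\mathrm{NewtonArgMax}(f,x_0)$ denotes the result of a Newton maximization of the function $f$ with starting point $x_0$, using a classical backtracking line search method. Algorithm MEMIP. Given $\widehat{W}^1\in\mathbb{R}^{d(d+1)}$, set $\widehat{X}^1=\mathrm{NewtonArgMax}(\widehat{\mathcal{L}}^1,\widehat{W}^1)$. For $k=2,\dots,K$, define $\widehat{W}^k\in\mathbb{R}^{d(d+1)k}$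 by $\widehat{W}^k_{uv,j}=\widehat{X}^{k-1}_{uv,j}$ for $1\le j\le k-1$ and $\widehat{W}^k_{uv,k}=0$ (for all $u\in\{1,\dots,d\}$, $v\in\{0,\dots,d\}$), and set $\widehat{X}^k=\mathrm{NewtonArgMax}(\widehat{\mathcal{L}}^k,\widehat{W}^k)$. The number of Newton iterations is the total over $k=1,\dots,K$.
   Formalization: Added: ε ≤ 1/2 (for ε near 1 the bound turns negative, so no fixed C works); the log-likelihood of degree 1 at the starting vector is > −∞ (else Newton cannot start); and the degree-K supremum is finite (else no estimate is within ε of it). *)

theory Defs
  imports "HOL-Analysis.Analysis" "HOL-Library.While_Combinator"
begin

text \<open>
  The dimension \<open>d (d + 1) k\<close> grows along the algorithm, so a vector of \<open>\<real>\<^sup>I\<close>, for a finite index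
  set \<open>I\<close>, is a real function on an ambient index type that vanishes outside \<open>I\<close>.
\<close>

definition rspace :: "'i set \<Rightarrow> ('i \<Rightarrow> real) set" where
  "rspace I = {x. \<forall>i. i \<notin> I \<longrightarrow> x i = 0}"

section \<open>Newton maximization with backtracking line search\<close>

text \<open>
  Objectives are extended-real valued, with value \<open>-\<infinity>\<close> outside their domain. Derivatives are taken
  of the real part of the objective and are only meaningful in the interior of the domain.
\<close>

definition partial :: "'i \<Rightarrow> (('i \<Rightarrow> real) \<Rightarrow> real) \<Rightarrow> ('i \<Rightarrow> real) \<Rightarrow> real" where
  "partial i g x = deriv (\<lambda>t. g (x(i := t))) (x i)"

definition grad :: "(('i \<Rightarrow> real) \<Rightarrow> ereal) \<Rightarrow> ('i \<Rightarrow> real) \<Rightarrow> 'i \<Rightarrow> real" where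
  "grad f x i = partial i (\<lambda>y. real_of_ereal (f y)) x"

definition hess :: "(('i \<Rightarrow> real) \<Rightarrow> ereal) \<Rightarrow> ('i \<Rightarrow> real) \<Rightarrow> 'i \<Rightarrow> 'i \<Rightarrow> real" where
  "hess f x i j = partial i (partial j (\<lambda>y. real_of_ereal (f y))) x"

text \<open>
  The Newton direction solves \<open>\<nabla>\<^sup>2f(x) v = -\<nabla>f(x)\<close>. It is unique when the Hessian is invertible. For
  a singular Hessian an arbitrary solution is taken (and the choice is meaningless if there is none).
\<close>

definition newton_dir :: "'i set \<Rightarrow> (('i \<Rightarrow> real) \<Rightarrow> ereal) \<Rightarrow> ('i \<Rightarrow> real) \<Rightarrow> 'i \<Rightarrow> real" where
  "newton_dir I f x =
     (SOME v. v \<in> rspace I \<and> (\<forall>i\<in>I. (\<Sum>j\<in>I. hess f x i j * v j) = - grad f x i))"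

definition newton_slope :: "'i set \<Rightarrow> (('i \<Rightarrow> real) \<Rightarrow> ereal) \<Rightarrow> ('i \<Rightarrow> real) \<Rightarrow> real" where
  "newton_slope I f x = (\<Sum>i\<in>I. grad f x i * newton_dir I f x i)"

text \<open>
  The Newton decrement: by the Newton system, the slope along \<open>v\<close> is \<open>- v\<^sup>T \<nabla>\<^sup>2f(x) v\<close>, which is
  nonnegative for concave \<open>f\<close>.
\<close>

definition newton_decrement :: "'i set \<Rightarrow> (('i \<Rightarrow> real) \<Rightarrow> ereal) \<Rightarrow> ('i \<Rightarrow> real) \<Rightarrow> real" where
  "newton_decrement I f x = sqrt (newton_slope I f x)"

text \<open>
  Backtracking with parameters \<open>a\<close> (sufficient increase) and \<open>b\<close> (reduction factor): the step size
  starts at \<open>1\<close> and is multiplied by \<open>b\<close> until the sufficient increase condition holds. Points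
  outside the domain, where \<open>f\<close> is \<open>-\<infinity>\<close>, are rejected.
\<close>

definition backtrack ::
  "real \<Rightarrow> real \<Rightarrow> 'i set \<Rightarrow> (('i \<Rightarrow> real) \<Rightarrow> ereal) \<Rightarrow> ('i \<Rightarrow> real) \<Rightarrow> real" where
  "backtrack a b I f x =
     b ^ (LEAST m. f (\<lambda>i. x i + b ^ m * newton_dir I f x i)
                   \<ge> f x + ereal (a * b ^ m * newton_slope I f x))"

definition newton_update ::
  "real \<Rightarrow> real \<Rightarrow> 'i set \<Rightarrow> (('i \<Rightarrow> real) \<Rightarrow> ereal) \<Rightarrow> ('i \<Rightarrow> real) \<Rightarrow> 'i \<Rightarrow> real" where
  "newton_update a b I f x = (\<lambda>i. x i + backtrack a b I f x * newton_dir I f x i)"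

text \<open>
  Stopping test: \<open>-r - ln (1 - r)\<close> is the standard estimate of the optimality gap of a
  self-concordant objective at a point with Newton decrement \<open>r < 1\<close>. The test refers only to
  computable quantities, not to the unknown supremum.
\<close>

definition newton_stop :: "real \<Rightarrow> 'i set \<Rightarrow> (('i \<Rightarrow> real) \<Rightarrow> ereal) \<Rightarrow> ('i \<Rightarrow> real) \<Rightarrow> bool" where
  "newton_stop \<epsilon> I f x \<longleftrightarrow>
     (let r = newton_decrement I f x in r < 1 \<and> - r - ln (1 - r) \<le> \<epsilon>)"

text \<open>
  The result is paired with the number of Newton iterations performed; it is \<open>None\<close> if the stopping
  test is never met.
\<close>

definition newton_argmax ::
  "real \<Rightarrow> real \<Rightarrow> real \<Rightarrow> 'i set \<Rightarrow> (('i \<Rightarrow> real) \<Rightarrow> ereal) \<Rightarrow> ('i \<Rightarrow> real)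
    \<Rightarrow> (('i \<Rightarrow> real) \<times> nat) option" where
  "newton_argmax a b \<epsilon> I f x0 =
     while_option (\<lambda>(x, n). \<not> newton_stop \<epsilon> I f x)
                  (\<lambda>(x, n). (newton_update a b I f x, Suc n)) (x0, 0)"

section \<open>Hawkes data and objective functions\<close>

text \<open>An event is a pair of a time and a type.\<close>

record realization =
  t_start :: real
  t_end :: real
  events :: "(real \<times> nat) list"

definition hawkes_data :: "nat \<Rightarrow> realization list \<Rightarrow> bool" where
  "hawkes_data d H \<longleftrightarrow>
     H \<noteq> [] \<and> Min (t_start ` set H) = 0 \<and>
     (\<forall>h\<in>set H. t_start h \<le> t_end h \<and> sorted (map fst (events h)) \<and>
        (\<forall>(t, u)\<in>set (events h). t_start h \<le> t \<and> t \<le> t_end h \<and> u \<in> {1..d}))"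

text \<open>Indices \<open>(u, v, j)\<close>: affected type, triggering type (\<open>0\<close> for the background), degree.\<close>

definition param_idx :: "nat \<Rightarrow> nat \<Rightarrow> (nat \<times> nat \<times> nat) set" where
  "param_idx d k = {1..d} \<times> {0..d} \<times> {1..k}"

definition rate ::
  "real \<Rightarrow> nat \<Rightarrow> nat \<Rightarrow> realization \<Rightarrow> nat \<Rightarrow> real \<Rightarrow> (nat \<times> nat \<times> nat \<Rightarrow> real) \<Rightarrow> real" where
  "rate \<alpha> d k h u s X =
     (\<Sum>j=1..k. X (u, 0, j) * exp (- real j * \<alpha> * s)) +
     (\<Sum>v=1..d. \<Sum>j=1..k. X (u, v, j) *
        (\<Sum>(t, w) \<leftarrow> filter (\<lambda>(t, w). t < s \<and> w = v) (events h).
           exp (- (real j + 1) * \<alpha> * (s - t))))"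

definition ext_ln :: "real \<Rightarrow> ereal" where
  "ext_ln x = (if x \<le> 0 then - \<infinity> else ereal (ln x))"

definition loglik ::
  "real \<Rightarrow> nat \<Rightarrow> realization list \<Rightarrow> nat \<Rightarrow> (nat \<times> nat \<times> nat \<Rightarrow> real) \<Rightarrow> ereal" where
  "loglik \<alpha> d H k X =
     (\<Sum>h\<leftarrow>H. \<Sum>(t, u)\<leftarrow>events h. ext_ln (rate \<alpha> d k h u t X)) -
     ereal (\<Sum>h\<leftarrow>H. \<Sum>u=1..d. integral {t_start h..t_end h} (\<lambda>s. rate \<alpha> d k h u s X))"

definition sup_loglik :: "real \<Rightarrow> nat \<Rightarrow> realization list \<Rightarrow> nat \<Rightarrow> ereal" where
  "sup_loglik \<alpha> d H k = (SUP X\<in>rspace (param_idx d k). loglik \<alpha> d H k X)"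

section \<open>The algorithm MEMIP\<close>

definition warm_start ::
  "nat \<Rightarrow> (nat \<times> nat \<times> nat \<Rightarrow> real) \<Rightarrow> (nat \<times> nat \<times> nat \<Rightarrow> real)" where
  "warm_start k X = (\<lambda>(u, v, j). if 1 \<le> j \<and> j \<le> k - 1 then X (u, v, j) else 0)"

text \<open>
  The list of the estimates of degrees \<open>1, \<dots>, K\<close>, paired with the total number of Newton iterations;
  \<open>None\<close> if one of the Newton maximizations does not terminate.
\<close>

primrec memip ::
  "real \<Rightarrow> real \<Rightarrow> real \<Rightarrow> real \<Rightarrow> nat \<Rightarrow> realization list \<Rightarrow> (nat \<times> nat \<times> nat \<Rightarrow> real)
    \<Rightarrow> nat \<Rightarrow> ((nat \<times> nat \<times> nat \<Rightarrow> real) list \<times> nat) option" where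
  "memip a b \<epsilon> \<alpha> d H W1 0 = Some ([], 0)"
| "memip a b \<epsilon> \<alpha> d H W1 (Suc k) =
     (case memip a b \<epsilon> \<alpha> d H W1 k of
        None \<Rightarrow> None
      | Some (Xs, N) \<Rightarrow>
          (case newton_argmax a b \<epsilon> (param_idx d (Suc k)) (loglik \<alpha> d H (Suc k))
                  (if k = 0 then W1 else warm_start (Suc k) (last Xs)) of
             None \<Rightarrow> None
           | Some (X, n) \<Rightarrow> Some (Xs @ [X], N + n)))"

end

theory Submission
  imports Defs
begin

text \<open>
  Every relaxed log-likelihood has the form \<open>f(x) = \<Sum>m. ln \<langle>l\<^sub>m, x\<rangle> - \<langle>c, x\<rangle>\<close>, with one term per event, so it is
  self-concordant, and the analysis of damped Newton for self-concordant functions applies with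
  constants that depend on neither the data nor the dimension. For this concrete form every estimate can be
  read off from the relative changes \<open>p\<^sub>m = \<langle>l\<^sub>m, v\<rangle> / \<langle>l\<^sub>m, x\<rangle>\<close> of the intensities along the Newton
  direction \<open>v\<close>. The Newton decrement is \<open>r = \<parallel>p\<parallel>\<^sub>2\<close>, and all nonlinearity is controlled by
  \<open>\<omega>(s) = - s - ln (1 - s)\<close>, which satisfies \<open>\<Sum>m. \<omega>(p\<^sub>m) \<le> \<omega>(\<parallel>p\<parallel>\<^sub>2)\<close> (\<open>barrier_gap_sum_le\<close>).

  Four facts then give the complexity of one maximization. If \<open>r < 1\<close>, the supremum exceeds \<open>f(x)\<close> by at
  most \<open>\<omega>(r)\<close>, so that the stopping test is sound (\<open>optimality_gap\<close>). If \<open>t r < 1\<close>, a step of size \<open>t\<close> gains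
  at least \<open>t r\<^sup>2 - \<omega>(t r)\<close> (\<open>newton_line_gain\<close>), so backtracking accepts every size up to \<open>1 / (1 + r)\<close>, and as long
  as \<open>r > \<eta> = (1 - 2 a) / 4\<close> each step gains at least \<open>\<gamma> = a b \<eta>\<^sup>2 / (1 + \<eta>)\<close> (\<open>damped_step_gain\<close>). Once
  \<open>r \<le> \<eta>\<close> the full step is accepted, and a full step squares the decrement
  (\<open>newton_decrement_full_step\<close>). Hence there are at most \<open>(sup f - f(x\<^sub>0)) / \<gamma>\<close> damped steps, followed by
  at most \<open>log\<^sub>2 (log\<^sub>2 (1 / \<epsilon>))\<close> full ones (\<open>newton_argmax_converges\<close>).

  No strict concavity is available: the Hessian may be singular. Its kernel consists of the
  directions in which no intensity changes; a bounded \<open>f\<close> is constant along them, so the gradient lies in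
  the range of the Hessian and the Newton system is solvable (\<open>newton_dir_spec\<close>). All quantities above
  depend on the direction only through the \<open>p\<^sub>m\<close>, so the choice of the solution is immaterial.

  For the whole algorithm, the warm start has the same likelihood as the preceding estimate,
  which is within \<open>\<epsilon>\<close> of the preceding supremum. The gaps \<open>sup f\<^sub>k - f\<^sub>k(W\<^sup>k)\<close> therefore telescope, each
  degree adding an error of at most \<open>\<epsilon>\<close>, and \<open>C = 1 / \<gamma>\<close> works.
\<close>

section \<open>The gap function of a self-concordant objective\<close>

text \<open>
  This is \<open>\<omega>(s) = s\<^sup>2 / 2 + s\<^sup>3 / 3 + \<dots>\<close>, the error of the first-order expansion of \<open>- ln (1 - s)\<close>.
\<close>

definition barrier_gap :: "real \<Rightarrow> real" where
  "barrier_gap s = - s - ln (1 - s)"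

lemma barrier_gap_sums:
  assumes "\<bar>q\<bar> < 1"
  shows "(\<lambda>n. if n \<le> 1 then 0 else q ^ n / real n) sums barrier_gap q"
proof -
  have "(\<lambda>n. - ((- (- q)) ^ n) / of_nat n) sums ln (1 + - q)"
    using assms by (intro ln_series') auto
  then have "(\<lambda>n. q ^ n / real n) sums (- ln (1 - q))"
    using sums_minus by fastforce
  then have "(\<lambda>n. q ^ n / real n - (if n = 1 then q else 0)) sums (- ln (1 - q) - q)"
    by (intro sums_diff) (use sums_single[of 1 "\<lambda>_. q"] in auto)
  moreover have "(\<lambda>n. q ^ n / real n - (if n = 1 then q else 0)) =
      (\<lambda>n. if n \<le> 1 then 0 else q ^ n / real n)"
  proof
    fix n :: nat
    show "q ^ n / real n - (if n = 1 then q else 0) = (if n \<le> 1 then 0 else q ^ n / real n)"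
      by (cases "n = 0"; cases "n = 1") auto
  qed
  ultimately show ?thesis
    by (simp only: barrier_gap_def minus_diff_commute)
qed

text \<open>
  The power series of \<open>\<omega>\<close> starts at \<open>s\<^sup>2\<close> and has nonnegative coefficients, so that, termwise,
  \<open>\<omega>(q) / q\<^sup>2\<close> is at most \<open>\<omega>(r) / r\<^sup>2\<close>. The product form covers the value \<open>0\<close>.
\<close>

lemma barrier_gap_ratio_mono:
  assumes "\<bar>q\<bar> \<le> r" "r < 1"
  shows "r\<^sup>2 * barrier_gap q \<le> q\<^sup>2 * barrier_gap r"
proof (rule sums_le)
  show "(\<lambda>n. r\<^sup>2 * (if n \<le> 1 then 0 else q ^ n / real n)) sums (r\<^sup>2 * barrier_gap q)"
    "(\<lambda>n. q\<^sup>2 * (if n \<le> 1 then 0 else r ^ n / real n)) sums (q\<^sup>2 * barrier_gap r)"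
    using assms by (intro sums_mult barrier_gap_sums; simp)+
  fix n :: nat
  show "r\<^sup>2 * (if n \<le> 1 then 0 else q ^ n / real n) \<le> q\<^sup>2 * (if n \<le> 1 then 0 else r ^ n / real n)"
  proof (cases "n \<le> 1")
    case False
    then obtain k where n: "n = 2 + k"
      using nat_le_iff_add[of 2 n] by auto
    have "q ^ k \<le> r ^ k"
      using power_mono[OF assms(1), of k] by (metis abs_ge_zero abs_le_D1 power_abs)
    then have "(r\<^sup>2 * q\<^sup>2) * q ^ k / real n \<le> (r\<^sup>2 * q\<^sup>2) * r ^ k / real n"
      by (intro divide_right_mono mult_left_mono) auto
    moreover have "\<not> 2 + k \<le> 1" by simp
    ultimately show ?thesis
      unfolding n power_add by (simp only: if_False times_divide_eq_right mult_ac)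
  qed simp
qed

text \<open>
  Bounding each \<open>\<omega>(q\<^sub>m)\<close> by \<open>(q\<^sub>m\<^sup>2 / r\<^sup>2) \<omega>(r)\<close> turns the sum into a function of the Euclidean
  norm. This is what makes the later constants independent of the number of terms.
\<close>

lemma barrier_gap_sum_le:
  assumes "finite M" "(\<Sum>m\<in>M. (q m)\<^sup>2) = r\<^sup>2" "0 \<le> r" "r < 1"
  shows "(\<Sum>m\<in>M. barrier_gap (q m)) \<le> barrier_gap r"
    and "\<And>m. m \<in> M \<Longrightarrow> \<bar>q m\<bar> \<le> r"
proof -
  show le: "\<bar>q m\<bar> \<le> r" if "m \<in> M" for m
  proof -
    have "(q m)\<^sup>2 \<le> r\<^sup>2"
      unfolding assms(2)[symmetric] by (rule member_le_sum) (use that assms in auto)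
    then show ?thesis
      using assms(3) by (simp add: abs_le_square_iff[symmetric])
  qed
  show "(\<Sum>m\<in>M. barrier_gap (q m)) \<le> barrier_gap r"
  proof (cases "r = 0")
    case True
    then have "\<forall>m\<in>M. q m = 0"
      using le by force
    then show ?thesis
      using True by (simp add: barrier_gap_def)
  next
    case False
    have "r\<^sup>2 * (\<Sum>m\<in>M. barrier_gap (q m)) \<le> (\<Sum>m\<in>M. (q m)\<^sup>2 * barrier_gap r)"
      unfolding sum_distrib_left
      by (intro sum_mono barrier_gap_ratio_mono le assms)
    also have "\<dots> = r\<^sup>2 * barrier_gap r"
      by (simp add: sum_distrib_right[symmetric] assms(2))
    finally show ?thesis
      using False by simp
  qed
qed

lemma barrier_gap_le:
  assumes "0 \<le> s" "s < 1"
  shows "barrier_gap s \<le> s\<^sup>2 / (2 * (1 - s))"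
proof -
  let ?h = "\<lambda>s::real. s\<^sup>2 / (2 * (1 - s)) - barrier_gap s"
  have "?h 0 \<le> ?h s"
  proof (rule DERIV_nonneg_imp_nondecreasing[OF assms(1)])
    fix x assume x: "0 \<le> x" "x \<le> s"
    then have x1: "x < 1" using assms by simp
    have "(?h has_real_derivative (2 * x * (2 * (1 - x)) + x\<^sup>2 * 2) / (2 * (1 - x) * (2 * (1 - x)))
        - (- 1 + 1 / (1 - x))) (at x)"
      unfolding barrier_gap_def using x1 by (auto intro!: derivative_eq_intros)
    moreover have "(2 * x * (2 * (1 - x)) + x\<^sup>2 * 2) / (2 * (1 - x) * (2 * (1 - x)))
        - (- 1 + 1 / (1 - x)) = x\<^sup>2 / (2 * (1 - x)\<^sup>2)"
      using x1 by (simp add: divide_simps) (simp add: power2_eq_square algebra_simps)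
    ultimately have "(?h has_real_derivative x\<^sup>2 / (2 * (1 - x)\<^sup>2)) (at x)"
      by simp
    then show "\<exists>y. (?h has_real_derivative y) (at x) \<and> 0 \<le> y"
      by (intro exI conjI) auto
  qed
  then show ?thesis
    by (simp add: barrier_gap_def)
qed

text \<open>
  The conjugate of \<open>p \<mapsto> p - ln (1 + p)\<close> is \<open>\<omega>\<close>. This bounds the change of \<open>f\<close> over an arbitrary relative
  displacement \<open>p\<close> by a function of the Newton step \<open>q\<close> alone.
\<close>

lemma fenchel_young_ln:
  assumes "p > -1" "q < 1"
  shows "ln (1 + p) - p + q * p \<le> barrier_gap q"
proof -
  have "ln ((1 + p) * (1 - q)) \<le> (1 + p) * (1 - q) - 1"
    using assms by (intro ln_le_minus_one mult_pos_pos) auto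
  moreover have "ln ((1 + p) * (1 - q)) = ln (1 + p) + ln (1 - q)"
    using assms by (intro ln_mult_pos) auto
  moreover have "(1 + p) * (1 - q) = 1 + p - q - q * p"
    by (simp add: algebra_simps)
  ultimately show ?thesis
    by (simp add: barrier_gap_def)
qed

section \<open>Solvability of Gram systems\<close>

definition dot :: "'i set \<Rightarrow> ('i \<Rightarrow> real) \<Rightarrow> ('i \<Rightarrow> real) \<Rightarrow> real" where
  "dot I u x = (\<Sum>i\<in>I. u i * x i)"

lemma dot_cong: "(\<And>i. i \<in> I \<Longrightarrow> u i = v i) \<Longrightarrow> dot I u x = dot I v x"
  by (simp add: dot_def)

lemma dot_add_scale: "dot I u (\<lambda>i. x i + t * y i) = dot I u x + t * dot I u y"
  by (simp add: dot_def algebra_simps sum.distrib sum_distrib_left)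

lemma dot_add_scale_left: "dot I (\<lambda>i. x i + t * y i) u = dot I x u + t * dot I y u"
  by (simp add: dot_def algebra_simps sum.distrib sum_distrib_left)

lemma dot_sum_left: "dot I (\<lambda>i. \<Sum>m\<in>M. k m * u m i) x = (\<Sum>m\<in>M. k m * dot I (u m) x)"
  unfolding dot_def sum_distrib_left sum_distrib_right
  by (subst sum.swap) (simp add: mult_ac)

lemma dot_fun_upd:
  assumes "finite I" "i \<in> I"
  shows "dot I u (x(i := t)) = dot I u x + u i * (t - x i)"
  using assms by (simp add: dot_def sum.remove[where x = i] algebra_simps)

text \<open>
  The range of \<open>\<Sum>m. u\<^sub>m u\<^sub>m\<^sup>T\<close> is the orthogonal complement of the common kernel of the \<open>u\<^sub>m\<close>. The induction
  adds one vector \<open>u\<^sub>n\<close>. Either the kernel does not shrink; then \<open>u\<^sub>n\<close> is already in the range and a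
  rank-one (Sherman--Morrison) correction works. Or some kernel vector \<open>w\<close> of the old family has
  \<open>\<langle>u\<^sub>n, w\<rangle> \<noteq> 0\<close>; then moving along \<open>w\<close> adjusts the new coefficient without disturbing the old ones.
\<close>

lemma gram_solvable:
  fixes g :: "'i \<Rightarrow> real"
  assumes "finite I" "finite M"
    and "\<And>w. (\<forall>m\<in>M. dot I (u m) w = 0) \<Longrightarrow> dot I g w = 0"
  shows "\<exists>v. \<forall>i\<in>I. (\<Sum>m\<in>M. dot I (u m) v * u m i) = g i"
  using assms(2,3)
proof (induction M arbitrary: g rule: finite_induct)
  case empty
  have "g i = 0" if "i \<in> I" for i
  proof -
    have "dot I g (\<lambda>j. if j = i then 1 else 0) = 0"
      using empty by simp
    then show ?thesis
      using assms(1) that by (simp add: dot_def if_distrib[of "\<lambda>t. _ * t"] cong: if_cong)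
  qed
  then show ?case by simp
next
  case (insert n M)
  let ?G = "\<lambda>v i. \<Sum>m\<in>M. dot I (u m) v * u m i"
  show ?case
  proof (cases "\<forall>w. (\<forall>m\<in>M. dot I (u m) w = 0) \<longrightarrow> dot I (u n) w = 0")
    case True
    with insert.prems obtain v0 where v0: "\<forall>i\<in>I. ?G v0 i = g i"
      using insert.IH[of g] by auto
    from True obtain y where y: "\<forall>i\<in>I. ?G y i = u n i"
      using insert.IH[of "u n"] by auto
    have "dot I (u n) y = dot I (?G y) y"
      using y by (simp add: dot_def)
    also have "\<dots> = (\<Sum>m\<in>M. (dot I (u m) y)\<^sup>2)"
      by (simp add: dot_sum_left power2_eq_square)
    finally have pos: "1 + dot I (u n) y > 0"
      by (simp add: add_pos_nonneg sum_nonneg)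
    define s where "s = dot I (u n) v0 / (1 + dot I (u n) y)"
    have s: "dot I (u n) v0 - s * dot I (u n) y = s"
      using pos by (simp add: s_def field_simps)
    have "(\<Sum>m\<in>insert n M. dot I (u m) (\<lambda>i. v0 i + (- s) * y i) * u m i) = g i" if "i \<in> I" for i
    proof -
      have "?G (\<lambda>i. v0 i + (- s) * y i) i = ?G v0 i - s * ?G y i"
        by (simp only: dot_add_scale) (simp add: algebra_simps sum_subtractf sum_distrib_left)
      also have "\<dots> = g i - s * u n i"
        using v0 y that by simp
      finally show ?thesis
        using insert.hyps s by (simp only: sum.insert dot_add_scale) (simp add: algebra_simps)
    qed
    then show ?thesis by blast
  next
    case False
    then obtain w where w: "\<forall>m\<in>M. dot I (u m) w = 0" "dot I (u n) w \<noteq> 0"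
      by blast
    define k where "k = dot I g w / dot I (u n) w"
    have "\<exists>v. \<forall>i\<in>I. ?G v i = g i + (- k) * u n i"
    proof (rule insert.IH)
      fix z assume z: "\<forall>m\<in>M. dot I (u m) z = 0"
      let ?t = "dot I (u n) z / dot I (u n) w"
      have "dot I g (\<lambda>i. z i + (- ?t) * w i) = 0"
        by (rule insert.prems) (use z w in \<open>auto simp only: dot_add_scale ball_simps, auto\<close>)
      then show "dot I (\<lambda>i. g i + (- k) * u n i) z = 0"
        unfolding dot_add_scale dot_add_scale_left k_def by (simp add: mult.commute)
    qed
    then obtain v0 where v0: "\<forall>i\<in>I. ?G v0 i = g i - k * u n i"
      by auto
    define s where "s = (k - dot I (u n) v0) / dot I (u n) w"
    have "(\<Sum>m\<in>insert n M. dot I (u m) (\<lambda>i. v0 i + s * w i) * u m i) = g i" if "i \<in> I" for i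
    proof -
      have "?G (\<lambda>i. v0 i + s * w i) i = ?G v0 i"
        using w by (intro sum.cong) (auto simp: dot_add_scale)
      moreover have "dot I (u n) (\<lambda>i. v0 i + s * w i) = k"
        unfolding dot_add_scale s_def using w by simp
      ultimately show ?thesis
        using insert.hyps v0 that by simp
    qed
    then show ?thesis by blast
  qed
qed

section \<open>Derivatives of a log-linear objective\<close>

text \<open>
  The objective \<open>f\<close> is a parameter constrained by its two cases, rather than a constant defined in the
  locale, so that the results apply literally to the likelihoods.
\<close>

locale log_linear_objective =
  fixes I :: "'i set" and M :: "'m set" and l :: "'m \<Rightarrow> 'i \<Rightarrow> real" and c :: "'i \<Rightarrow> real"
    and f :: "('i \<Rightarrow> real) \<Rightarrow> ereal"
  assumes finite_I: "finite I" and finite_M: "finite M"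
    and f_inside: "(\<forall>m\<in>M. 0 < dot I (l m) x) \<Longrightarrow>
      f x = ereal ((\<Sum>m\<in>M. ln (dot I (l m) x)) - dot I c x)"
    and f_outside: "\<not> (\<forall>m\<in>M. 0 < dot I (l m) x) \<Longrightarrow> f x = - \<infinity>"
begin

definition feasible :: "('i \<Rightarrow> real) \<Rightarrow> bool" where
  "feasible x \<longleftrightarrow> (\<forall>m\<in>M. 0 < dot I (l m) x)"

definition val :: "('i \<Rightarrow> real) \<Rightarrow> real" where
  "val x = (\<Sum>m\<in>M. ln (dot I (l m) x)) - dot I c x"

lemma f_eq: "f x = (if feasible x then ereal (val x) else - \<infinity>)"
  using f_inside f_outside by (simp add: feasible_def val_def)

lemma val_diff:
  assumes "feasible x" "feasible y"
  shows "val y - val x =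
    (\<Sum>m\<in>M. ln (1 + dot I (l m) (\<lambda>i. y i - x i) / dot I (l m) x)) - dot I c (\<lambda>i. y i - x i)"
proof -
  have "dot I (l m) (\<lambda>i. y i - x i) = dot I (l m) y - dot I (l m) x" for m
    using dot_add_scale[of I "l m" y "-1" x] by simp
  moreover have "dot I c (\<lambda>i. y i - x i) = dot I c y - dot I c x"
    using dot_add_scale[of I c y "-1" x] by simp
  moreover have "ln (1 + (dot I (l m) y - dot I (l m) x) / dot I (l m) x) =
      ln (dot I (l m) y) - ln (dot I (l m) x)" if "m \<in> M" for m
  proof -
    have "dot I (l m) x > 0" "dot I (l m) y > 0" using assms that by (auto simp: feasible_def)
    then show ?thesis
      by (simp add: diff_divide_distrib ln_div)
  qed
  ultimately show ?thesis
    by (simp add: val_def sum_subtractf)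
qed

lemma eventually_feasible:
  assumes "feasible x" "i \<in> I"
  shows "\<forall>\<^sub>F t in nhds (x i). feasible (x(i := t))"
  unfolding feasible_def
proof (intro eventually_ball_finite[OF finite_M] ballI)
  fix m assume m: "m \<in> M"
  have "((\<lambda>t. dot I (l m) x + l m i * (t - x i)) \<longlongrightarrow> dot I (l m) x + l m i * (x i - x i)) (nhds (x i))"
    by (intro tendsto_intros filterlim_ident)
  then show "\<forall>\<^sub>F t in nhds (x i). 0 < dot I (l m) (x(i := t))"
    unfolding dot_fun_upd[OF finite_I assms(2)]
    by (rule order_tendstoD) (use assms m in \<open>auto simp: feasible_def\<close>)
qed

lemma grad_eq:
  assumes "feasible x" "i \<in> I"
  shows "grad f x i = (\<Sum>m\<in>M. l m i / dot I (l m) x) - c i"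
proof -
  have "((\<lambda>t. val (x(i := t))) has_real_derivative (\<Sum>m\<in>M. l m i / dot I (l m) x) - c i) (at (x i))"
    unfolding val_def dot_fun_upd[OF finite_I assms(2)]
    using assms by (auto intro!: derivative_eq_intros sum.cong simp: feasible_def)
  moreover have "deriv (\<lambda>t. real_of_ereal (f (x(i := t)))) (x i) = deriv (\<lambda>t. val (x(i := t))) (x i)"
    by (rule deriv_cong_ev)
      (use eventually_feasible[OF assms] in \<open>auto elim!: eventually_mono simp: f_eq\<close>)
  ultimately show ?thesis
    by (simp add: grad_def partial_def DERIV_imp_deriv)
qed

lemma hess_eq:
  assumes "feasible x" "i \<in> I" "j \<in> I"
  shows "hess f x i j = - (\<Sum>m\<in>M. l m i * l m j / (dot I (l m) x)\<^sup>2)"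
proof -
  have "((\<lambda>t. (\<Sum>m\<in>M. l m j / dot I (l m) (x(i := t))) - c j) has_real_derivative
      - (\<Sum>m\<in>M. l m i * l m j / (dot I (l m) x)\<^sup>2)) (at (x i))"
    unfolding dot_fun_upd[OF finite_I assms(2)] using assms
    by (auto intro!: derivative_eq_intros sum.cong
        simp: feasible_def power2_eq_square sum_negf[symmetric] divide_simps)
  moreover have "deriv (\<lambda>t. grad f (x(i := t)) j) (x i) =
      deriv (\<lambda>t. (\<Sum>m\<in>M. l m j / dot I (l m) (x(i := t))) - c j) (x i)"
    by (rule deriv_cong_ev)
      (use eventually_feasible[OF assms(1,2)] assms(3) in \<open>auto elim!: eventually_mono simp: grad_eq\<close>)
  ultimately show ?thesis
    by (simp add: hess_def grad_def partial_def DERIV_imp_deriv)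
qed

end

section \<open>The Newton direction\<close>

locale bounded_log_linear_objective = log_linear_objective I M l c f
  for I :: "'i set" and M :: "'m set" and l c f +
  assumes bounded: "\<exists>B. \<forall>x\<in>rspace I. f x \<le> ereal B"
begin

text \<open>
  Along a direction that changes no \<open>\<langle>l\<^sub>m, x\<rangle>\<close> the objective is affine on a whole line, and a bounded affine
  function is constant.
\<close>

lemma linear_part_vanishes_on_kernel:
  assumes x: "x \<in> rspace I" "feasible x"
    and w: "\<forall>m\<in>M. dot I (l m) w = 0"
  shows "dot I c w = 0"
proof (rule ccontr)
  assume nz: "dot I c w \<noteq> 0"
  obtain B where B: "\<And>y. y \<in> rspace I \<Longrightarrow> f y \<le> ereal B"
    using bounded by blast
  \<comment> \<open>Only \<open>w\<close> restricted to \<open>I\<close> stays in the space on which \<open>f\<close> is bounded.\<close>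
  define w' where "w' = (\<lambda>i. if i \<in> I then w i else 0)"
  have w': "dot I u w' = dot I u w" for u
    by (simp add: dot_def w'_def)
  \<comment> \<open>The step at which the affine function takes the value \<open>B + 1\<close>.\<close>
  define t where "t = (val x - B - 1) / dot I c w"
  let ?y = "\<lambda>i. x i + t * w' i"
  have "feasible ?y"
    using x w by (auto simp: feasible_def dot_add_scale w')
  moreover have "val ?y = val x - t * dot I c w"
    using w by (simp add: val_def dot_add_scale w')
  then have "val ?y = B + 1"
    using nz by (simp add: t_def)
  moreover have "?y \<in> rspace I"
    using x by (auto simp: rspace_def w'_def)
  ultimately show False
    using B[of ?y] by (simp add: f_eq)
qed

text \<open>
  With \<open>u\<^sub>m = l\<^sub>m / \<langle>l\<^sub>m, x\<rangle>\<close> the negated Hessian is the Gram operator \<open>\<Sum>m. u\<^sub>m u\<^sub>m\<^sup>T\<close>, and the gradient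
  annihilates its kernel.
\<close>

lemma newton_dir_spec:
  assumes "x \<in> rspace I" "feasible x"
  shows "newton_dir I f x \<in> rspace I"
    and "\<And>i. i \<in> I \<Longrightarrow> (\<Sum>j\<in>I. hess f x i j * newton_dir I f x j) = - grad f x i"
proof -
  let ?u = "\<lambda>m i. l m i / dot I (l m) x"
  have u: "dot I (?u m) w = dot I (l m) w / dot I (l m) x" for m w
    by (simp add: dot_def sum_divide_distrib)
  have g: "dot I (grad f x) w = (\<Sum>m\<in>M. dot I (?u m) w) - dot I c w" for w
  proof -
    have "dot I (grad f x) w = dot I (\<lambda>i. (\<Sum>m\<in>M. 1 * ?u m i) + (- 1) * c i) w"
      by (rule dot_cong) (use assms in \<open>simp add: grad_eq\<close>)
    then show ?thesis
      by (simp only: dot_add_scale_left dot_sum_left) simp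
  qed
  have "\<exists>v. \<forall>i\<in>I. (\<Sum>m\<in>M. dot I (?u m) v * ?u m i) = grad f x i"
  proof (rule gram_solvable[OF finite_I finite_M])
    fix w assume w: "\<forall>m\<in>M. dot I (?u m) w = 0"
    then have "\<forall>m\<in>M. dot I (l m) w = 0"
      using assms by (force simp: u feasible_def)
    then show "dot I (grad f x) w = 0"
      using w linear_part_vanishes_on_kernel[OF assms] by (simp add: g)
  qed
  then obtain v where v: "\<forall>i\<in>I. (\<Sum>m\<in>M. dot I (?u m) v * ?u m i) = grad f x i"
    by blast
  define v' where "v' = (\<lambda>i. if i \<in> I then v i else 0)"
  have "v' \<in> rspace I \<and> (\<forall>i\<in>I. (\<Sum>j\<in>I. hess f x i j * v' j) = - grad f x i)"
  proof (intro conjI ballI)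
    show "v' \<in> rspace I" by (simp add: v'_def rspace_def)
    fix i assume i: "i \<in> I"
    have "(\<Sum>j\<in>I. hess f x i j * v' j) = (\<Sum>j\<in>I. - (\<Sum>m\<in>M. ?u m i * ?u m j) * v j)"
      using assms i by (intro sum.cong) (auto simp: hess_eq v'_def power2_eq_square)
    also have "\<dots> = - dot I (\<lambda>j. \<Sum>m\<in>M. ?u m i * ?u m j) v"
      by (simp add: dot_def sum_negf)
    also have "\<dots> = - grad f x i"
      using v i by (simp only: dot_sum_left) (simp add: mult.commute)
    finally show "(\<Sum>j\<in>I. hess f x i j * v' j) = - grad f x i" .
  qed
  then have "newton_dir I f x \<in> rspace I \<and>
      (\<forall>i\<in>I. (\<Sum>j\<in>I. hess f x i j * newton_dir I f x j) = - grad f x i)"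
    unfolding newton_dir_def
    by (rule someI[where P = "\<lambda>v. v \<in> rspace I \<and> (\<forall>i\<in>I. (\<Sum>j\<in>I. hess f x i j * v j) = - grad f x i)"])
  then show "newton_dir I f x \<in> rspace I"
    "\<And>i. i \<in> I \<Longrightarrow> (\<Sum>j\<in>I. hess f x i j * newton_dir I f x j) = - grad f x i"
    by auto
qed

text \<open>
  In these coordinates of the Newton direction the Hessian norm is the Euclidean norm, which is the
  Newton decrement.
\<close>

definition rel_step :: "('i \<Rightarrow> real) \<Rightarrow> 'm \<Rightarrow> real" where
  "rel_step x m = dot I (l m) (newton_dir I f x) / dot I (l m) x"

text \<open>
  Tested against an arbitrary \<open>w\<close>, the Newton system expresses the gradient, and hence the linear part
  \<open>c\<close>, through the relative steps. From here on \<open>c\<close> can be eliminated everywhere.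
\<close>

lemma newton_system:
  assumes "x \<in> rspace I" "feasible x"
  shows "dot I (grad f x) w = (\<Sum>m\<in>M. rel_step x m * (dot I (l m) w / dot I (l m) x))"
    and "dot I c w = (\<Sum>m\<in>M. (1 - rel_step x m) * (dot I (l m) w / dot I (l m) x))"
proof -
  let ?v = "newton_dir I f x"
  have *: "grad f x i = (\<Sum>m\<in>M. (rel_step x m / dot I (l m) x) * l m i)" if i: "i \<in> I" for i
  proof -
    have "- grad f x i = (\<Sum>j\<in>I. - (\<Sum>m\<in>M. (l m i / (dot I (l m) x)\<^sup>2) * l m j) * ?v j)"
      unfolding newton_dir_spec(2)[OF assms i, symmetric]
      using assms i by (intro sum.cong) (auto simp: hess_eq)
    also have "\<dots> = - dot I (\<lambda>j. \<Sum>m\<in>M. (l m i / (dot I (l m) x)\<^sup>2) * l m j) ?v"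
      by (simp add: dot_def sum_negf)
    also have "\<dots> = - (\<Sum>m\<in>M. (rel_step x m / dot I (l m) x) * l m i)"
      by (simp only: dot_sum_left) (simp add: rel_step_def power2_eq_square mult_ac)
    finally show ?thesis by simp
  qed
  have "dot I (grad f x) w = dot I (\<lambda>i. \<Sum>m\<in>M. (rel_step x m / dot I (l m) x) * l m i) w"
    by (rule dot_cong) (rule *)
  then show 1: "dot I (grad f x) w = (\<Sum>m\<in>M. rel_step x m * (dot I (l m) w / dot I (l m) x))"
    by (simp only: dot_sum_left) simp
  have "dot I (grad f x) w = dot I (\<lambda>i. (\<Sum>m\<in>M. (1 / dot I (l m) x) * l m i) + (- 1) * c i) w"
    by (rule dot_cong) (use assms in \<open>simp add: grad_eq\<close>)
  then have "dot I c w = (\<Sum>m\<in>M. dot I (l m) w / dot I (l m) x) - dot I (grad f x) w"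
    by (simp only: dot_add_scale_left dot_sum_left) simp
  then show "dot I c w = (\<Sum>m\<in>M. (1 - rel_step x m) * (dot I (l m) w / dot I (l m) x))"
    by (simp add: 1 algebra_simps diff_divide_distrib sum_subtractf)
qed

lemma newton_slope_eq:
  assumes "x \<in> rspace I" "feasible x"
  shows "newton_slope I f x = (\<Sum>m\<in>M. (rel_step x m)\<^sup>2)"
  using newton_system(1)[OF assms, of "newton_dir I f x"]
  by (simp add: newton_slope_def dot_def[of I "grad f x"] rel_step_def[symmetric] power2_eq_square)

lemma newton_decrement_square:
  assumes "x \<in> rspace I" "feasible x"
  shows "(\<Sum>m\<in>M. (rel_step x m)\<^sup>2) = (newton_decrement I f x)\<^sup>2"
    and "newton_slope I f x = (newton_decrement I f x)\<^sup>2" and "0 \<le> newton_decrement I f x"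
  unfolding newton_decrement_def by (auto simp: newton_slope_eq[OF assms] sum_nonneg)

section \<open>Estimates in terms of the Newton decrement\<close>

text \<open>
  After elimination of \<open>c\<close>, the difference of the values is a sum of terms \<open>ln (1 + q) - q + p\<^sub>m q\<close>, to each of
  which the Fenchel inequality applies. The bound holds for every feasible \<open>y\<close>, however far away.
\<close>

lemma optimality_gap:
  assumes x: "x \<in> rspace I" "feasible x" and r: "newton_decrement I f x < 1"
    and y: "feasible y"
  shows "val y - val x \<le> barrier_gap (newton_decrement I f x)"
proof -
  let ?q = "\<lambda>m. dot I (l m) (\<lambda>i. y i - x i) / dot I (l m) x"
  note sq = newton_decrement_square[OF x]
  have q: "?q m > - 1" if "m \<in> M" for m
  proof -
    have "dot I (l m) (\<lambda>i. y i - x i) = dot I (l m) y - dot I (l m) x"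
      using dot_add_scale[of I "l m" y "-1" x] by simp
    moreover have "dot I (l m) x > 0" "dot I (l m) y > 0"
      using x y that by (auto simp: feasible_def)
    ultimately show ?thesis
      by (simp add: field_simps)
  qed
  have "val y - val x = (\<Sum>m\<in>M. ln (1 + ?q m) - ?q m + rel_step x m * ?q m)"
    unfolding val_diff[OF x(2) y] newton_system(2)[OF x]
    by (simp add: algebra_simps diff_divide_distrib sum.distrib sum_subtractf)
  also have "\<dots> \<le> (\<Sum>m\<in>M. barrier_gap (rel_step x m))"
  proof (intro sum_mono fenchel_young_ln q)
    fix m assume "m \<in> M"
    then have "\<bar>rel_step x m\<bar> \<le> newton_decrement I f x"
      using barrier_gap_sum_le(2)[OF finite_M sq(1,3) r] by blast
    then show "rel_step x m < 1" using r by simp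
  qed
  also have "\<dots> \<le> barrier_gap (newton_decrement I f x)"
    by (rule barrier_gap_sum_le[OF finite_M sq(1,3) r])
  finally show ?thesis .
qed

text \<open>
  Along the Newton direction the first-order gain is \<open>t r\<^sup>2\<close> and the loss of second and higher order is
  exactly \<open>\<Sum>m. \<omega>(- t p\<^sub>m)\<close>. For \<open>t r < 1\<close> no intensity can vanish, so the step stays feasible.
\<close>

lemma newton_line_gain:
  assumes x: "x \<in> rspace I" "feasible x" and t: "0 \<le> t" "t * newton_decrement I f x < 1"
  defines "y \<equiv> \<lambda>i. x i + t * newton_dir I f x i"
  shows "feasible y"
    and "val x + t * (newton_decrement I f x)\<^sup>2 - barrier_gap (t * newton_decrement I f x) \<le> val y"
proof -
  let ?r = "newton_decrement I f x" and ?v = "newton_dir I f x"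
  note sq = newton_decrement_square[OF x]
  have "(\<Sum>m\<in>M. (- (t * rel_step x m))\<^sup>2) = (t * ?r)\<^sup>2"
    by (simp add: power_mult_distrib sum_distrib_left[symmetric] sq)
  note gap = barrier_gap_sum_le[OF finite_M this _ t(2)]
  have nn: "0 \<le> t * ?r" using t sq by simp
  have dy: "dot I (l m) y = dot I (l m) x * (1 + t * rel_step x m)" if "m \<in> M" for m
  proof -
    have "dot I (l m) x > 0" using x that by (auto simp: feasible_def)
    then show ?thesis
      by (simp add: y_def dot_add_scale rel_step_def field_simps)
  qed
  show fy: "feasible y"
    unfolding feasible_def
  proof
    fix m assume m: "m \<in> M"
    then have "\<bar>- (t * rel_step x m)\<bar> < 1"
      using gap(2)[OF nn m] t by linarith
    then have "0 < 1 + t * rel_step x m" by linarith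
    then show "0 < dot I (l m) y"
      using x m by (simp add: dy feasible_def)
  qed
  have diff: "(\<lambda>i. y i - x i) = (\<lambda>i. t * ?v i)"
    by (simp add: y_def)
  have dt: "dot I u (\<lambda>i. t * ?v i) = t * dot I u ?v" for u
    by (simp add: dot_def sum_distrib_left algebra_simps)
  have "val y - val x = (\<Sum>m\<in>M. ln (1 + t * rel_step x m)) - t * dot I c ?v"
    unfolding val_diff[OF x(2) fy] diff dt by (simp add: rel_step_def)
  also have "dot I c ?v = (\<Sum>m\<in>M. rel_step x m) - ?r\<^sup>2"
    unfolding newton_system(2)[OF x] sq(1)[symmetric]
    by (simp add: rel_step_def[symmetric] algebra_simps sum_subtractf power2_eq_square)
  finally have "val y - val x = t * ?r\<^sup>2 - (\<Sum>m\<in>M. barrier_gap (- (t * rel_step x m)))"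
    by (simp add: barrier_gap_def algebra_simps sum_subtractf sum_distrib_left)
  then show "val x + t * ?r\<^sup>2 - barrier_gap (t * ?r) \<le> val y"
    using gap(1)[OF nn] by linarith
qed

text \<open>
  At \<open>y = x + v\<close> the intensities are \<open>\<langle>l\<^sub>m, x\<rangle> (1 + p\<^sub>m)\<close>, while \<open>c\<close> is the sum of
  \<open>(1 - p\<^sub>m) l\<^sub>m / \<langle>l\<^sub>m, x\<rangle>\<close>, so the gradient
  at \<open>y\<close> is \<open>\<Sum>m. (1 - (1 - p\<^sub>m) (1 + p\<^sub>m)) l\<^sub>m / \<langle>l\<^sub>m, y\<rangle> = \<Sum>m. p\<^sub>m\<^sup>2 l\<^sub>m / \<langle>l\<^sub>m, y\<rangle>\<close>: the terms
  of first order cancel. Pairing it with the next Newton direction, whose relative steps have norm \<open>s\<close>,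
  gives \<open>s\<^sup>2 \<le> r\<^sup>2 s\<close>.
\<close>

lemma newton_decrement_full_step:
  assumes x: "x \<in> rspace I" "feasible x" and r: "newton_decrement I f x < 1"
  defines "y \<equiv> \<lambda>i. x i + newton_dir I f x i"
  shows "newton_decrement I f y \<le> (newton_decrement I f x)\<^sup>2"
proof -
  let ?r = "newton_decrement I f x" and ?s = "newton_decrement I f y" and ?w = "newton_dir I f y"
  note sq = newton_decrement_square[OF x]
  have y: "y \<in> rspace I" "feasible y"
    using x newton_dir_spec(1)[OF x] newton_line_gain(1)[OF x, of 1] r
    by (auto simp: y_def rspace_def)
  note sqy = newton_decrement_square[OF y]
  have rel: "dot I (l m) ?w / dot I (l m) x = (1 + rel_step x m) * rel_step y m" if "m \<in> M" for m
  proof -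
    have "dot I (l m) x > 0" "dot I (l m) y > 0"
      using x y that by (auto simp: feasible_def)
    moreover have "dot I (l m) y = dot I (l m) x * (1 + rel_step x m)"
      using dot_add_scale[of I "l m" x 1 "newton_dir I f x"] \<open>dot I (l m) x > 0\<close>
      by (simp add: y_def rel_step_def field_simps)
    ultimately show ?thesis
      by (simp add: rel_step_def[of y] zero_less_mult_iff)
  qed
  \<comment> \<open>Both sides are \<open>\<langle>c, w\<rangle>\<close> for the Newton direction \<open>w\<close> at \<open>y\<close>: on the left by the Newton system at
    \<open>y\<close>, on the right by the one at \<open>x\<close>.\<close>
  have "(\<Sum>m\<in>M. (1 - rel_step y m) * rel_step y m) =
      (\<Sum>m\<in>M. (1 - rel_step x m) * ((1 + rel_step x m) * rel_step y m))"
    using newton_system(2)[OF x, of ?w] newton_system(2)[OF y, of ?w]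
    by (simp add: rel rel_step_def[of y, symmetric])
  then have "?s\<^sup>2 = (\<Sum>m\<in>M. (rel_step x m)\<^sup>2 * rel_step y m)"
    unfolding sqy(1)[symmetric] by (simp add: algebra_simps sum_subtractf power2_eq_square)
  also have "\<dots> \<le> (\<Sum>m\<in>M. (rel_step x m)\<^sup>2 * ?s)"
  proof (intro sum_mono mult_left_mono)
    fix m assume "m \<in> M"
    then have "(rel_step y m)\<^sup>2 \<le> ?s\<^sup>2"
      unfolding sqy(1)[symmetric] by (intro member_le_sum) (use finite_M in auto)
    then show "rel_step y m \<le> ?s"
      using sqy(3) by (rule power2_le_imp_le)
  qed simp
  also have "\<dots> = ?r\<^sup>2 * ?s"
    by (simp add: sum_distrib_right[symmetric] sq(1))
  finally show ?thesis
    using sqy(3) by (cases "?s = 0") (auto simp: power2_eq_square)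
qed


section \<open>Backtracking and the number of Newton iterations\<close>

text \<open>
  As \<open>\<omega>(s) \<le> s\<^sup>2 / (2 (1 - s))\<close>, the condition holds whenever \<open>t \<le> 2 (1 - a) (1 - t r)\<close>. For
  \<open>t \<le> 1 / (1 + r)\<close> this follows from \<open>t \<le> 1 - t r\<close> and \<open>2 (1 - a) \<ge> 1\<close>. For \<open>t = 1\<close> the excess of
  \<open>2 (1 - a)\<close> over \<open>1\<close>, which is four times the threshold, has to compensate the factor \<open>1 - r\<close>.
\<close>

lemma sufficient_increase:
  assumes x: "x \<in> rspace I" "feasible x" and a: "0 < a" "a < 1 / 2" and t: "0 < t"
    and cond: "t \<le> 1 / (1 + newton_decrement I f x) \<or>
      t = 1 \<and> newton_decrement I f x \<le> (1 - 2 * a) / 4"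
  shows "f (\<lambda>i. x i + t * newton_dir I f x i) \<ge> f x + ereal (a * t * newton_slope I f x)"
proof -
  let ?r = "newton_decrement I f x" and ?y = "\<lambda>i. x i + t * newton_dir I f x i"
  note sq = newton_decrement_square[OF x]
  \<comment> \<open>The common factor \<open>r\<close> is kept, so that \<open>r = 0\<close> needs no separate treatment.\<close>
  have key: "t * ?r < 1 \<and> ?r * t \<le> 2 * (1 - a) * ?r * (1 - t * ?r)"
    using cond
  proof
    assume "t \<le> 1 / (1 + ?r)"
    then have t1: "t * (1 + ?r) \<le> 1"
      using sq(3) by (simp add: field_simps)
    then have "t \<le> 1 - t * ?r" by (simp add: algebra_simps)
    also have "\<dots> \<le> 2 * (1 - a) * (1 - t * ?r)"
      using mult_right_mono[of 1 "2 * (1 - a)" "1 - t * ?r"] a t1 t by (simp add: algebra_simps)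
    finally have "?r * t \<le> ?r * (2 * (1 - a) * (1 - t * ?r))"
      using sq(3) by (rule mult_left_mono)
    then show ?thesis
      using t1 t by (simp add: algebra_simps)
  next
    assume t1: "t = 1 \<and> ?r \<le> (1 - 2 * a) / 4"
    define e where "e = (1 - 2 * a) / 4"
    have e: "0 < e" "e < 1 / 4" "2 * (1 - a) = 1 + 4 * e" "?r \<le> e"
      using a t1 by (auto simp: e_def)
    have "1 \<le> 1 + e * (3 - 4 * e)"
      using e by simp
    also have "\<dots> = (1 + 4 * e) * (1 - e)"
      by (simp add: algebra_simps)
    also have "\<dots> \<le> (1 + 4 * e) * (1 - ?r)"
      using e by (intro mult_left_mono) auto
    finally have "?r * 1 \<le> ?r * (2 * (1 - a) * (1 - ?r))"
      unfolding e(3) using sq(3) by (rule mult_left_mono)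
    then show ?thesis
      using t1 e by (simp add: mult_ac)
  qed
  note gain = newton_line_gain[OF x less_imp_le[OF t] conjunct1[OF key]]
  have "barrier_gap (t * ?r) \<le> (t * ?r)\<^sup>2 / (2 * (1 - t * ?r))"
    using key t sq(3) by (intro barrier_gap_le) auto
  also have "\<dots> \<le> (1 - a) * t * ?r\<^sup>2"
  proof -
    have "(t * ?r) * (?r * t) \<le> (t * ?r) * (2 * (1 - a) * ?r * (1 - t * ?r))"
      using key t sq(3) by (intro mult_left_mono) auto
    then have "(t * ?r)\<^sup>2 \<le> ((1 - a) * t * ?r\<^sup>2) * (2 * (1 - t * ?r))"
      by (simp only: power2_eq_square mult_ac)
    then show ?thesis
      using key by (subst pos_divide_le_eq) auto
  qed
  finally have "val x + a * t * ?r\<^sup>2 \<le> val ?y"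
    using gain(2) by (simp add: algebra_simps)
  then show ?thesis
    using gain(1) x(2) by (simp add: f_eq sq(2))
qed

text \<open>
  Since every size up to \<open>1 / (1 + r)\<close> is accepted, backtracking ends, and the accepted size
  falls below this threshold by at most the factor \<open>b\<close>.
\<close>

lemma backtrack_spec:
  assumes x: "x \<in> rspace I" "feasible x" and a: "0 < a" "a < 1 / 2" and b: "0 < b" "b < 1"
  defines "y \<equiv> newton_update a b I f x"
  shows "b / (1 + newton_decrement I f x) \<le> backtrack a b I f x"
    and "y \<in> rspace I" and "feasible y"
    and "val x + a * backtrack a b I f x * (newton_decrement I f x)\<^sup>2 \<le> val y"
    and "newton_decrement I f x \<le> (1 - 2 * a) / 4 \<Longrightarrow> backtrack a b I f x = 1"
proof -
  let ?r = "newton_decrement I f x"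
  define P where "P = (\<lambda>m. f (\<lambda>i. x i + b ^ m * newton_dir I f x i)
    \<ge> f x + ereal (a * b ^ m * newton_slope I f x))"
  have t: "backtrack a b I f x = b ^ (LEAST m. P m)"
    by (simp add: backtrack_def P_def)
  note sq = newton_decrement_square[OF x]
  have P: "P m" if "b ^ m \<le> 1 / (1 + ?r)" for m
    unfolding P_def using that b by (intro sufficient_increase[OF x a]) auto
  obtain m where "b ^ m < 1 / (1 + ?r)"
    using real_arch_pow_inv[of "1 / (1 + ?r)" b] b sq(3) by auto
  then have ex: "P m" by (intro P) auto
  then have L: "P (LEAST m. P m)" by (rule LeastI)
  show "b / (1 + ?r) \<le> backtrack a b I f x"
  proof (cases "LEAST m. P m")
    case 0
    then show ?thesis
      using b sq(3) by (simp add: t)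
  next
    case (Suc n)
    then have "\<not> P n"
      using not_less_Least[of n P] by simp
    then have "1 / (1 + ?r) < b ^ n"
      using P[of n] by linarith
    then have "b * (1 / (1 + ?r)) \<le> b * b ^ n"
      using b by (intro mult_left_mono) auto
    then show ?thesis
      by (simp add: t Suc)
  qed
  show "y \<in> rspace I"
    using x newton_dir_spec(1)[OF x] by (auto simp: y_def newton_update_def rspace_def)
  have "f y \<ge> ereal (val x + a * backtrack a b I f x * ?r\<^sup>2)"
    using L x by (simp add: P_def t y_def newton_update_def f_eq sq(2))
  then show "feasible y" "val x + a * backtrack a b I f x * ?r\<^sup>2 \<le> val y"
    by (auto simp: f_eq split: if_splits)
  show "backtrack a b I f x = 1" if "?r \<le> (1 - 2 * a) / 4"
  proof -
    \<comment> \<open>The search starts at size \<open>b\<^sup>0 = 1\<close>.\<close>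
    have "P 0"
      unfolding P_def using that by (intro sufficient_increase[OF x a]) auto
    then have "(LEAST m. P m) = 0"
      using Least_le[of P 0] by simp
    then show ?thesis by (simp add: t)
  qed
qed

text \<open>
  The guaranteed gain \<open>a b r\<^sup>2 / (1 + r)\<close> increases with \<open>r\<close>, so a lower bound \<open>e\<close> on the decrement gives a
  uniform gain.
\<close>

lemma damped_step_gain:
  assumes x: "x \<in> rspace I" "feasible x" and a: "0 < a" "a < 1 / 2" and b: "0 < b" "b < 1"
    and e: "0 < e" "e < newton_decrement I f x"
  shows "val x + a * b * e\<^sup>2 / (1 + e) \<le> val (newton_update a b I f x)"
proof -
  let ?r = "newton_decrement I f x"
  note bt = backtrack_spec[OF x a b]
  have "0 \<le> (?r - e) * (?r + e + e * ?r)"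
    using e by simp
  then have "e\<^sup>2 * (1 + ?r) \<le> ?r\<^sup>2 * (1 + e)"
    by (simp add: power2_eq_square algebra_simps)
  then have "e\<^sup>2 / (1 + e) \<le> ?r\<^sup>2 / (1 + ?r)"
    using e by (simp add: divide_simps mult_ac)
  then have "a * b * (e\<^sup>2 / (1 + e)) \<le> a * b * (?r\<^sup>2 / (1 + ?r))"
    using a b by (intro mult_left_mono) auto
  also have "\<dots> = (a * ?r\<^sup>2) * (b / (1 + ?r))"
    by simp
  also have "\<dots> \<le> (a * ?r\<^sup>2) * backtrack a b I f x"
    using a bt(1) by (intro mult_left_mono) auto
  finally show ?thesis
    using bt(4) by (simp add: mult_ac)
qed

lemma pure_step_decrement:
  assumes x: "x \<in> rspace I" "feasible x" and a: "0 < a" "a < 1 / 2" and b: "0 < b" "b < 1"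
    and r: "newton_decrement I f x \<le> (1 - 2 * a) / 4"
  shows "newton_decrement I f (newton_update a b I f x) \<le> (newton_decrement I f x)\<^sup>2"
  using newton_decrement_full_step[OF x] backtrack_spec(5)[OF x a b r] r a
  by (simp add: newton_update_def)

text \<open>
  As \<open>\<eta> < 1 / 4\<close>, after \<open>k\<close> full steps the decrement is at most \<open>(1 / 4)\<close> to the power \<open>2\<^sup>k\<close>. Working with base
  \<open>1 / 4\<close> instead of \<open>1 / 2\<close> saves one iteration, which pays for rounding \<open>log\<^sub>2 (log\<^sub>2 (1 / \<epsilon>))\<close> down to an
  integer; no additive constant is left in the bound.
\<close>

lemma newton_argmax_converges:
  assumes x0: "x0 \<in> rspace I" "feasible x0" and a: "0 < a" "a < 1 / 2" and b: "0 < b" "b < 1"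
    and \<epsilon>: "0 < \<epsilon>" "\<epsilon> \<le> 1 / 2"
    and B: "\<And>y. y \<in> rspace I \<Longrightarrow> f y \<le> ereal B"
    and \<eta>_def: "\<eta> = (1 - 2 * a) / 4" and \<gamma>_def: "\<gamma> = a * b * \<eta>\<^sup>2 / (1 + \<eta>)"
  shows "\<exists>x n. newton_argmax a b \<epsilon> I f x0 = Some (x, n) \<and> x \<in> rspace I \<and> f x \<noteq> - \<infinity> \<and>
    (\<forall>y. f y \<le> f x + ereal \<epsilon>) \<and>
    real n \<le> (B - val x0) / \<gamma> + log 2 (log 2 (1 / \<epsilon>))"
proof -
  have \<eta>: "0 < \<eta>" "\<eta> < 1 / 4" using a by (auto simp: \<eta>_def)
  have \<gamma>: "0 < \<gamma>" using a b \<eta> by (simp add: \<gamma>_def)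
  define z where "z n = (newton_update a b I f ^^ n) x0" for n
  define r where "r n = newton_decrement I f (z n)" for n
  have z_Suc: "z (Suc n) = newton_update a b I f (z n)" for n
    by (simp add: z_def)
  have z: "z n \<in> rspace I" "feasible (z n)" for n
  proof (induction n)
    case 0
    { case 1 show ?case using x0 by (simp add: z_def) }
    { case 2 show ?case using x0 by (simp add: z_def) }
  next
    case (Suc n)
    { case 1 show ?case unfolding z_Suc by (rule backtrack_spec(2)[OF Suc a b]) }
    { case 2 show ?case unfolding z_Suc by (rule backtrack_spec(3)[OF Suc a b]) }
  qed
  have r0: "0 \<le> r n" for n
    unfolding r_def by (rule newton_decrement_square[OF z])
  \<comment> \<open>Damped phase: the values grow linearly, so it cannot last.\<close>
  have damped: "val x0 + real n * \<gamma> \<le> val (z n)" if "\<forall>k<n. \<eta> < r k" for n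
    using that
  proof (induction n)
    case 0
    then show ?case by (simp add: z_def)
  next
    case (Suc n)
    then have "val (z n) + \<gamma> \<le> val (z (Suc n))"
      unfolding z_Suc \<gamma>_def using \<eta> by (intro damped_step_gain[OF z a b]) (auto simp: r_def)
    then show ?case
      using Suc by (simp add: algebra_simps)
  qed
  have val_le: "val (z n) \<le> B" for n
    using B[OF z(1)[of n]] z(2)[of n] by (simp add: f_eq)
  have "\<exists>n. r n \<le> \<eta>"
  proof (rule ccontr)
    assume "\<nexists>n. r n \<le> \<eta>"
    then have "real n * \<gamma> \<le> B - val x0" for n
      using damped[of n] val_le[of n] by (force simp: not_le)
    moreover obtain n where "B - val x0 < real n * \<gamma>"
      using ex_less_of_nat_mult[OF \<gamma>] by blast
    ultimately show False by (meson not_le)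
  qed
  then obtain n1 where n1: "r n1 \<le> \<eta>" "\<And>k. k < n1 \<Longrightarrow> \<eta> < r k"
    using exists_least_iff[of "\<lambda>n. r n \<le> \<eta>"] by (auto simp: not_le)
  \<comment> \<open>Quadratic phase: it is never left, since squaring keeps the decrement below \<open>\<eta>\<close>.\<close>
  have pure: "r (n1 + k) \<le> \<eta> ^ (2 ^ k)" for k
  proof (induction k)
    case 0
    then show ?case using n1 by simp
  next
    case (Suc k)
    have "\<eta> ^ (2 ^ k) \<le> \<eta> ^ 1"
      using \<eta> by (intro power_decreasing) auto
    with Suc have "r (n1 + k) \<le> \<eta>" by simp
    then have "r (n1 + Suc k) \<le> (r (n1 + k))\<^sup>2"
      unfolding r_def add_Suc_right z_Suc \<eta>_def by (rule pure_step_decrement[OF z a b])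
    also have "\<dots> \<le> (\<eta> ^ (2 ^ k))\<^sup>2"
      using Suc r0 by (rule power_mono)
    also have "\<dots> = \<eta> ^ (2 ^ Suc k)"
      by (simp add: power_mult[symmetric] mult.commute)
    finally show ?case .
  qed
  define L where "L = log 2 (log 2 (1 / \<epsilon>))"
  have logeps: "1 \<le> log 2 (1 / \<epsilon>)"
    using \<epsilon> by (simp add: le_log_iff field_simps)
  then have L0: "0 \<le> L" by (simp add: L_def)
  define l2 where "l2 = nat \<lfloor>L\<rfloor>"
  have l2: "real l2 \<le> L" "L \<le> real (l2 + 1)"
    using L0 by (auto simp: l2_def) linarith+
  have stop: "newton_stop \<epsilon> I f (z (n1 + l2))"
  proof -
    let ?s = "r (n1 + l2)"
    have s: "?s \<le> (1 / 4) ^ (2 ^ l2)"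
      using pure[of l2] power_mono[of \<eta> "1/4" "2 ^ l2"] \<eta> by linarith
    have "(1 / 4 :: real) ^ (2 ^ l2) \<le> (1 / 4) ^ 1"
      by (intro power_decreasing) auto
    with s have s4: "?s \<le> 1 / 4" by simp
    have "log 2 (1 / \<epsilon>) = 2 powr L"
      using logeps by (simp add: L_def)
    also have "\<dots> \<le> 2 powr real (l2 + 1)"
      using l2 by (intro powr_mono) auto
    also have "\<dots> = real (2 ^ (l2 + 1))"
      by (simp only: powr_realpow of_nat_power) (simp add: powr_realpow)
    finally have "1 / \<epsilon> \<le> 2 powr real (2 ^ (l2 + 1))"
      using \<epsilon> by (simp add: log_le_iff)
    also have "\<dots> = 2 ^ (2 ^ (l2 + 1))"
      by (rule powr_realpow) simp
    also have "\<dots> = 4 ^ (2 ^ l2)"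
      by (simp add: power_mult)
    finally have "(1 / 4) ^ (2 ^ l2) \<le> \<epsilon>"
      using \<epsilon> by (simp add: power_divide field_simps)
    with s have "?s \<le> \<epsilon>" by linarith
    have "barrier_gap ?s \<le> ?s\<^sup>2 / (2 * (1 - ?s))"
      using r0 s4 by (intro barrier_gap_le) (auto intro: le_less_trans)
    also have "\<dots> \<le> ?s"
    proof -
      have "?s * ?s \<le> ?s * (2 * (1 - ?s))"
        using r0 s4 by (intro mult_left_mono) auto
      then show ?thesis
        using s4 by (simp add: pos_divide_le_eq power2_eq_square)
    qed
    finally show ?thesis
      using \<open>?s \<le> \<epsilon>\<close> s4
      by (simp add: newton_stop_def Let_def barrier_gap_def r_def)
  qed
  let ?b = "\<lambda>(x, n). \<not> newton_stop \<epsilon> I f x"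
  let ?c = "\<lambda>(x, n). (newton_update a b I f x, Suc n)"
  \<comment> \<open>The loop stops at the first iterate that passes the test, which may come earlier than
    the iterate \<open>n1 + l2\<close>.\<close>
  have iter: "(?c ^^ k) (x0, 0) = (z k, k)" for k
    by (induction k) (auto simp: z_def)
  define n where "n = (LEAST k. newton_stop \<epsilon> I f (z k))"
  have n_stop: "newton_stop \<epsilon> I f (z n)" and n_le: "n \<le> n1 + l2"
    using stop by (auto simp: n_def intro: LeastI Least_le)
  have "newton_argmax a b \<epsilon> I f x0 = Some (z n, n)"
    unfolding newton_argmax_def while_option_def iter using stop by (auto simp: n_def)
  moreover have "f y \<le> f (z n) + ereal \<epsilon>" for y
  proof (cases "feasible y")
    case True
    have "r n < 1" "barrier_gap (r n) \<le> \<epsilon>"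
      using n_stop by (auto simp: newton_stop_def Let_def r_def barrier_gap_def)
    then show ?thesis
      using optimality_gap[OF z _ True, of n] z(2)[of n] True by (simp add: f_eq r_def)
  qed (simp add: f_eq)
  moreover have "real n \<le> (B - val x0) / \<gamma> + L"
  proof -
    have "real n1 * \<gamma> \<le> B - val x0"
      using damped[of n1] n1 val_le[of n1] by force
    then have "real n1 \<le> (B - val x0) / \<gamma>"
      using \<gamma> by (simp add: pos_le_divide_eq)
    then show ?thesis
      using n_le l2 by linarith
  qed
  ultimately show ?thesis
    using z[of n] by (auto simp: f_eq L_def)
qed

end


section \<open>The Hawkes log-likelihood as a log-linear objective\<close>

definition rate_coeff :: "real \<Rightarrow> realization \<Rightarrow> nat \<Rightarrow> real \<Rightarrow> nat \<times> nat \<times> nat \<Rightarrow> real" where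
  "rate_coeff \<alpha> h u s = (\<lambda>(u', v, j). if u' \<noteq> u then 0
     else if v = 0 then exp (- real j * \<alpha> * s)
     else (\<Sum>(t, w) \<leftarrow> filter (\<lambda>(t, w). t < s \<and> w = v) (events h). exp (- (real j + 1) * \<alpha> * (s - t))))"

lemma rate_linear:
  assumes "u \<in> {1..d}"
  shows "rate \<alpha> d k h u s X = dot (param_idx d k) (rate_coeff \<alpha> h u s) X"
proof -
  let ?G = "\<lambda>u' v j. rate_coeff \<alpha> h u s (u', v, j) * X (u', v, j)"
  have "dot (param_idx d k) (rate_coeff \<alpha> h u s) X = (\<Sum>u'=1..d. \<Sum>v=0..d. \<Sum>j=1..k. ?G u' v j)"
    by (simp add: dot_def param_idx_def sum.cartesian_product split_def)
  also have "\<dots> = (\<Sum>u'=1..d. if u' = u then (\<Sum>v=0..d. \<Sum>j=1..k. ?G u v j) else 0)"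
    by (intro sum.cong) (auto simp: rate_coeff_def)
  also have "\<dots> = (\<Sum>v=0..d. \<Sum>j=1..k. ?G u v j)"
    using assms by simp
  also have "\<dots> = (\<Sum>j=1..k. ?G u 0 j) + (\<Sum>v=1..d. \<Sum>j=1..k. ?G u v j)"
    by (simp add: sum.atLeast_Suc_atMost)
  also have "\<dots> = rate \<alpha> d k h u s X"
    unfolding rate_def
    by (intro arg_cong2[where f = "(+)"] sum.cong) (auto simp: rate_coeff_def mult.commute)
  finally show ?thesis ..
qed

lemma sum_list_filter_if: "sum_list (map g (filter P xs)) = (\<Sum>x\<leftarrow>xs. if P x then g x else 0)"
  for g :: "'a \<Rightarrow> 'b::monoid_add"
  by (induction xs) auto

lemma integrable_sum_list:
  fixes g :: "'a \<Rightarrow> real \<Rightarrow> real"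
  assumes "\<And>x. x \<in> set xs \<Longrightarrow> g x integrable_on S"
  shows "(\<lambda>s. \<Sum>x\<leftarrow>xs. g x s) integrable_on S"
  using assms by (induction xs) (auto intro!: integrable_add integrable_0)

text \<open>
  Integrability is what makes the compensator linear in the parameters. The triggering terms jump
  at the event times, but each is continuous on a half-line up to a null set.
\<close>

lemma rate_coeff_integrable: "(\<lambda>s. rate_coeff \<alpha> h u s i) integrable_on {p..q}"
proof -
  obtain u' v j where i: "i = (u', v, j)" by (cases i)
  have one: "(\<lambda>s. if t < s \<and> w = v then exp (\<kappa> * (s - t)) else 0) integrable_on {p..q}"
    for \<kappa> t :: real and w
  proof (cases "w = v")
    case True
    let ?e = "\<lambda>s. exp (\<kappa> * (s - t))"
    have "?e integrable_on {max p t..q}"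
      by (intro integrable_continuous_real continuous_intros)
    moreover have "negligible ({max p t..q} - {p..q} \<inter> {t<..} \<union> ({p..q} \<inter> {t<..} - {max p t..q}))"
      by (rule negligible_subset[of "{t}"]) auto
    ultimately have "?e integrable_on ({p..q} \<inter> {t<..})"
      using integrable_spike_set_eq by blast
    then have "(\<lambda>s. if s \<in> {t<..} then ?e s else 0) integrable_on {p..q}"
      by (simp only: integrable_restrict_Int Int_commute)
    then show ?thesis
      using True by (simp only: greaterThan_iff simp_thms)
  qed (simp add: integrable_0)
  consider "u' \<noteq> u" | "u' = u" "v = 0" | "u' = u" "v \<noteq> 0" by blast
  then show ?thesis
  proof cases
    case 1
    then show ?thesis by (simp add: i rate_coeff_def integrable_0)
  next
    case 2
    have "(\<lambda>s. exp (- real j * \<alpha> * s)) integrable_on {p..q}"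
      by (intro integrable_continuous_real continuous_intros)
    with 2 show ?thesis by (simp add: i rate_coeff_def)
  next
    case 3
    then show ?thesis
      by (simp add: i rate_coeff_def sum_list_filter_if split_def integrable_sum_list one)
  qed
qed

lemma finite_param_idx: "finite (param_idx d k)"
  by (simp add: param_idx_def)

lemma integral_rate:
  assumes "u \<in> {1..d}"
  shows "integral {p..q} (\<lambda>s. rate \<alpha> d k h u s X) =
    dot (param_idx d k) (\<lambda>i. integral {p..q} (\<lambda>s. rate_coeff \<alpha> h u s i)) X"
  unfolding rate_linear[OF assms] dot_def
  by (subst integral_sum[OF finite_param_idx])
    (auto intro: integrable_on_mult_left rate_coeff_integrable)

definition event_list :: "realization list \<Rightarrow> (realization \<times> real \<times> nat) list" where
  "event_list H = concat (map (\<lambda>h. map (Pair h) (events h)) H)"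

definition event_coeff :: "real \<Rightarrow> realization list \<Rightarrow> nat \<Rightarrow> nat \<times> nat \<times> nat \<Rightarrow> real" where
  "event_coeff \<alpha> H m = (case event_list H ! m of (h, t, u) \<Rightarrow> rate_coeff \<alpha> h u t)"

definition compensator_coeff :: "real \<Rightarrow> nat \<Rightarrow> realization list \<Rightarrow> nat \<times> nat \<times> nat \<Rightarrow> real" where
  "compensator_coeff \<alpha> d H i =
     (\<Sum>h\<leftarrow>H. \<Sum>u=1..d. integral {t_start h..t_end h} (\<lambda>s. rate_coeff \<alpha> h u s i))"

lemma dot_sum_list_left: "dot I (\<lambda>i. \<Sum>x\<leftarrow>xs. g x i) y = (\<Sum>x\<leftarrow>xs. dot I (g x) y)"
  by (induction xs) (simp_all add: dot_def sum.distrib distrib_right)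

lemma loglik_linear:
  assumes "hawkes_data d H"
  shows "loglik \<alpha> d H k X =
    (\<Sum>m<length (event_list H). ext_ln (dot (param_idx d k) (event_coeff \<alpha> H m) X)) -
    ereal (dot (param_idx d k) (compensator_coeff \<alpha> d H) X)"
proof -
  let ?g = "\<lambda>(h, t, u). ext_ln (rate \<alpha> d k h u t X)"
  have "(\<Sum>h\<leftarrow>H. \<Sum>(t, u)\<leftarrow>events h. ext_ln (rate \<alpha> d k h u t X)) = sum_list (map ?g (event_list H))"
    unfolding event_list_def by (induction H) (simp_all add: comp_def split_def)
  also have "\<dots> = (\<Sum>m<length (event_list H). ?g (event_list H ! m))"
    by (simp add: sum_list_sum_nth atLeast0LessThan)
  also have "\<dots> = (\<Sum>m<length (event_list H). ext_ln (dot (param_idx d k) (event_coeff \<alpha> H m) X))"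
  proof (intro sum.cong refl)
    fix m assume "m \<in> {..<length (event_list H)}"
    then have "event_list H ! m \<in> set (event_list H)" by simp
    moreover obtain h t u where e: "event_list H ! m = (h, t, u)" by (cases "event_list H ! m")
    ultimately have "h \<in> set H" "(t, u) \<in> set (events h)"
      by (auto simp: event_list_def)
    then have "u \<in> {1..d}"
      using assms unfolding hawkes_data_def by blast
    then show "?g (event_list H ! m) = ext_ln (dot (param_idx d k) (event_coeff \<alpha> H m) X)"
      by (simp add: e event_coeff_def rate_linear)
  qed
  finally have 1: "(\<Sum>h\<leftarrow>H. \<Sum>(t, u)\<leftarrow>events h. ext_ln (rate \<alpha> d k h u t X)) = \<dots>" .
  have "(\<Sum>h\<leftarrow>H. \<Sum>u=1..d. integral {t_start h..t_end h} (\<lambda>s. rate \<alpha> d k h u s X)) =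
      (\<Sum>h\<leftarrow>H. dot (param_idx d k) (\<lambda>i. \<Sum>u=1..d. 1 * integral {t_start h..t_end h} (\<lambda>s. rate_coeff \<alpha> h u s i)) X)"
    by (simp only: dot_sum_left) (simp add: integral_rate)
  also have "\<dots> = dot (param_idx d k) (compensator_coeff \<alpha> d H) X"
    by (simp add: dot_sum_list_left[symmetric] compensator_coeff_def[abs_def])
  finally show ?thesis
    unfolding loglik_def 1 by simp
qed

lemma loglik_log_linear:
  assumes "hawkes_data d H"
  shows "log_linear_objective (param_idx d k) {..<length (event_list H)} (event_coeff \<alpha> H)
    (compensator_coeff \<alpha> d H) (loglik \<alpha> d H k)"
proof
  let ?M = "{..<length (event_list H)}" and ?D = "\<lambda>m x. dot (param_idx d k) (event_coeff \<alpha> H m) x"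
  show "finite (param_idx d k)" "finite ?M"
    by (simp_all add: finite_param_idx)
  fix x
  show "loglik \<alpha> d H k x = ereal ((\<Sum>m\<in>?M. ln (?D m x)) - dot (param_idx d k) (compensator_coeff \<alpha> d H) x)"
    if "\<forall>m\<in>?M. 0 < ?D m x"
  proof -
    have "(\<Sum>m\<in>?M. ext_ln (?D m x)) = (\<Sum>m\<in>?M. ereal (ln (?D m x)))"
      using that by (intro sum.cong) (auto simp: ext_ln_def not_le[symmetric])
    then show ?thesis
      by (simp add: loglik_linear[OF assms])
  qed
  show "loglik \<alpha> d H k x = - \<infinity>" if "\<not> (\<forall>m\<in>?M. 0 < ?D m x)"
  proof -
    from that obtain m where m: "m \<in> ?M" "\<not> 0 < ?D m x" by blast
    \<comment> \<open>One nonpositive intensity forces the value \<open>-\<infinity>\<close> because no term equals \<open>\<infinity>\<close>.\<close>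
    have "(\<Sum>m\<in>?M. ext_ln (?D m x)) = ext_ln (?D m x) + (\<Sum>m\<in>?M - {m}. ext_ln (?D m x))"
      using m by (intro sum.remove) auto
    moreover have "(\<Sum>m\<in>?M - {m}. ext_ln (?D m x)) \<noteq> \<infinity>"
      by (auto simp: sum_Pinfty ext_ln_def split: if_splits)
    ultimately have "(\<Sum>m\<in>?M. ext_ln (?D m x)) = - \<infinity>"
      using m by (cases "\<Sum>m\<in>?M - {m}. ext_ln (?D m x)") (simp_all add: ext_ln_def[of "?D m x"])
    then show ?thesis
      by (simp add: loglik_linear[OF assms])
  qed
qed

section \<open>Warm starts and the total number of iterations\<close>

lemma rspace_param_idx_Suc: "rspace (param_idx d k) \<subseteq> rspace (param_idx d (Suc k))"
  by (auto simp: rspace_def param_idx_def)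

text \<open>
  Vectors of lower degree are extended by zero, so in the ambient function space the warm start
  is the preceding estimate itself, and the likelihoods of successive degrees agree on it.
\<close>

lemma warm_start_Suc:
  assumes "X \<in> rspace (param_idx d k)"
  shows "warm_start (Suc k) X = X"
  using assms by (fastforce simp: warm_start_def rspace_def param_idx_def)

lemma loglik_Suc:
  assumes "X \<in> rspace (param_idx d k)"
  shows "loglik \<alpha> d H (Suc k) X = loglik \<alpha> d H k X"
proof -
  have "X (u, v, Suc k) = 0" for u v
    using assms by (auto simp: rspace_def param_idx_def)
  then have "rate \<alpha> d (Suc k) h u s X = rate \<alpha> d k h u s X" for h u s
    by (simp add: rate_def)
  then show ?thesis
    by (simp add: loglik_def)
qed

lemma sup_loglik_mono:
  assumes "k \<le> K"
  shows "sup_loglik \<alpha> d H k \<le> sup_loglik \<alpha> d H K"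
proof (rule lift_Suc_mono_le[OF _ assms])
  fix n
  show "sup_loglik \<alpha> d H n \<le> sup_loglik \<alpha> d H (Suc n)"
    unfolding sup_loglik_def
  proof (rule SUP_mono)
    fix X assume X: "X \<in> rspace (param_idx d n)"
    then show "\<exists>Y\<in>rspace (param_idx d (Suc n)). loglik \<alpha> d H n X \<le> loglik \<alpha> d H (Suc n) Y"
      using rspace_param_idx_Suc[of d n] by (intro bexI[of _ X]) (auto simp: loglik_Suc)
  qed
qed

theorem proposition4:
  fixes a b :: real
  assumes "0 < a" and "a < 1 / 2" and "0 < b" and "b < 1"
  shows "\<exists>C::real. C > 0 \<and>
    (\<forall>(\<epsilon>::real) (\<alpha>::real) (d::nat) (K::nat) (H::realization list) (W1::nat \<times> nat \<times> nat \<Rightarrow> real).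
       0 < \<epsilon> \<and> \<epsilon> \<le> 1 / 2 \<and> 0 < \<alpha> \<and> 1 \<le> d \<and> 1 \<le> K \<and> hawkes_data d H \<and>
       W1 \<in> rspace (param_idx d 1) \<and> loglik \<alpha> d H 1 W1 \<noteq> - \<infinity> \<and>
       sup_loglik \<alpha> d H K < \<infinity> \<longrightarrow>
       (\<exists>Xs N. memip a b \<epsilon> \<alpha> d H W1 K = Some (Xs, N) \<and> length Xs = K \<and>
          (\<forall>k\<in>{1..K}. Xs ! (k - 1) \<in> rspace (param_idx d k) \<and>
             \<bar>loglik \<alpha> d H k (Xs ! (k - 1)) - sup_loglik \<alpha> d H k\<bar> \<le> ereal \<epsilon>) \<and>
          ereal (real N) \<le>
            ereal C * (sup_loglik \<alpha> d H K - loglik \<alpha> d H 1 W1) +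
            ereal (real K * (log 2 (log 2 (1 / \<epsilon>)) + C * \<epsilon>))))"
proof -
  define \<eta> where "\<eta> = (1 - 2 * a) / 4"
  define \<gamma> where "\<gamma> = a * b * \<eta>\<^sup>2 / (1 + \<eta>)"
  have \<gamma>: "0 < \<gamma>"
    using assms by (simp add: \<gamma>_def \<eta>_def divide_pos_pos add_pos_pos)
  show ?thesis
  proof (intro exI[of _ "1 / \<gamma>"] conjI allI impI; (elim conjE)?)
    show "0 < 1 / \<gamma>" using \<gamma> by simp
    fix \<epsilon> \<alpha> :: real and d K :: nat and H W1
    assume \<epsilon>: "0 < \<epsilon>" "\<epsilon> \<le> 1 / 2" and K: "1 \<le> K" and H: "hawkes_data d H"
      and W1: "W1 \<in> rspace (param_idx d 1)" "loglik \<alpha> d H 1 W1 \<noteq> - \<infinity>"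
      and fin: "sup_loglik \<alpha> d H K < \<infinity>"
    define F where "F = loglik \<alpha> d H"
    define L where "L = log 2 (log 2 (1 / \<epsilon>))"
    define S where "S k = real_of_ereal (sup_loglik \<alpha> d H k)" for k
    define w1 where "w1 = real_of_ereal (F 1 W1)"
    have le_sup: "F k X \<le> sup_loglik \<alpha> d H k" if "X \<in> rspace (param_idx d k)" for k X
      using that by (auto simp: F_def sup_loglik_def intro: SUP_upper)
    have S: "sup_loglik \<alpha> d H k = ereal (S k)" if "1 \<le> k" "k \<le> K" for k
    proof -
      have "F 1 W1 \<le> sup_loglik \<alpha> d H 1" by (rule le_sup[OF W1(1)])
      also have "\<dots> \<le> sup_loglik \<alpha> d H k" using that by (intro sup_loglik_mono) auto
      finally have "sup_loglik \<alpha> d H k \<noteq> - \<infinity>" using W1(2) by (auto simp: F_def)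
      moreover have "sup_loglik \<alpha> d H k < \<infinity>"
        using sup_loglik_mono[OF that(2)] fin by (rule le_less_trans)
      ultimately show ?thesis
        by (cases "sup_loglik \<alpha> d H k") (auto simp: S_def)
    qed
    have w1: "F 1 W1 = ereal w1"
      using le_sup[OF W1(1)] S[of 1] K W1(2) by (cases "F 1 W1") (auto simp: w1_def F_def)
    have newton: "\<exists>X n. newton_argmax a b \<epsilon> (param_idx d k) (F k) W = Some (X, n) \<and>
        X \<in> rspace (param_idx d k) \<and> (\<exists>y. F k X = ereal y \<and> S k - \<epsilon> \<le> y \<and> y \<le> S k) \<and>
        real n \<le> (S k - w) / \<gamma> + L"
      if k: "1 \<le> k" "k \<le> K" and W: "W \<in> rspace (param_idx d k)" "F k W = ereal w" for k W w
    proof -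
      interpret log_linear_objective "param_idx d k" "{..<length (event_list H)}" "event_coeff \<alpha> H"
        "compensator_coeff \<alpha> d H" "F k"
        unfolding F_def by (rule loglik_log_linear[OF H])
      have B: "F k y \<le> ereal (S k)" if "y \<in> rspace (param_idx d k)" for y
        using le_sup[OF that] S[OF k] by simp
      interpret bounded_log_linear_objective "param_idx d k" "{..<length (event_list H)}" "event_coeff \<alpha> H"
        "compensator_coeff \<alpha> d H" "F k"
        by unfold_locales (use B in blast)
      have W': "feasible W" "val W = w"
        using W(2) by (auto simp: f_eq split: if_splits)
      obtain X n where X: "newton_argmax a b \<epsilon> (param_idx d k) (F k) W = Some (X, n)"
        "X \<in> rspace (param_idx d k)" "F k X \<noteq> - \<infinity>" "\<And>y. F k y \<le> F k X + ereal \<epsilon>"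
        "real n \<le> (S k - w) / \<gamma> + L"
        using newton_argmax_converges[OF W(1) W'(1) assms \<epsilon> B \<eta>_def \<gamma>_def] W' by (auto simp: L_def)
      obtain y where y: "F k X = ereal y"
        using X(3) B[OF X(2)] by (cases "F k X") auto
      have "ereal (S k) \<le> ereal (y + \<epsilon>)"
        unfolding S[OF k, symmetric] unfolding sup_loglik_def F_def[symmetric]
        by (intro SUP_least) (use X(4) y in auto)
      then show ?thesis
        using X y B[OF X(2)] by auto
    qed
    \<comment> \<open>The bound is stated with the supremum of the current degree; passing to the next degree costs
      \<open>\<epsilon> / \<gamma>\<close>, because the warm start may lie \<open>\<epsilon>\<close> below that supremum.\<close>
    have main: "\<exists>Xs N. memip a b \<epsilon> \<alpha> d H W1 k = Some (Xs, N) \<and> length Xs = k \<and>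
        (\<forall>j\<in>{1..k}. Xs ! (j - 1) \<in> rspace (param_idx d j) \<and>
          (\<exists>y. F j (Xs ! (j - 1)) = ereal y \<and> S j - \<epsilon> \<le> y \<and> y \<le> S j)) \<and>
        real N \<le> (S k - w1) / \<gamma> + real k * (L + 1 / \<gamma> * \<epsilon>)"
      if "1 \<le> k" "k \<le> K" for k
      using that
    proof (induction k rule: nat_induct_at_least)
      case base
      obtain X n where "newton_argmax a b \<epsilon> (param_idx d 1) (F 1) W1 = Some (X, n)"
        "X \<in> rspace (param_idx d 1)" "\<exists>y. F 1 X = ereal y \<and> S 1 - \<epsilon> \<le> y \<and> y \<le> S 1"
        "real n \<le> (S 1 - w1) / \<gamma> + L"
        using newton[OF _ K W1(1) w1] by auto
      moreover have "0 \<le> 1 / \<gamma> * \<epsilon>" using \<gamma> \<epsilon> by simp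
      ultimately show ?case
        by (intro exI[of _ "[X]"] exI[of _ n]) (auto simp: F_def)
    next
      case (Suc k)
      then obtain Xs N where IH: "memip a b \<epsilon> \<alpha> d H W1 k = Some (Xs, N)" "length Xs = k"
        "\<And>j. j \<in> {1..k} \<Longrightarrow> Xs ! (j - 1) \<in> rspace (param_idx d j) \<and>
          (\<exists>y. F j (Xs ! (j - 1)) = ereal y \<and> S j - \<epsilon> \<le> y \<and> y \<le> S j)"
        "real N \<le> (S k - w1) / \<gamma> + real k * (L + 1 / \<gamma> * \<epsilon>)"
        by auto
      define W where "W = last Xs"
      have "W = Xs ! (k - 1)"
        using IH(2) Suc.hyps last_conv_nth[of Xs] by (cases "Xs = []") (auto simp: W_def)
      with IH(3)[of k] Suc.hyps obtain w where
        W: "W \<in> rspace (param_idx d k)" "F k W = ereal w" "S k - \<epsilon> \<le> w"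
        by auto
      have W': "W \<in> rspace (param_idx d (Suc k))" "F (Suc k) W = ereal w" "warm_start (Suc k) W = W"
        using W rspace_param_idx_Suc loglik_Suc[OF W(1)] warm_start_Suc[OF W(1)] by (auto simp: F_def)
      obtain X n where X: "newton_argmax a b \<epsilon> (param_idx d (Suc k)) (F (Suc k)) W = Some (X, n)"
        "X \<in> rspace (param_idx d (Suc k))"
        "\<exists>y. F (Suc k) X = ereal y \<and> S (Suc k) - \<epsilon> \<le> y \<and> y \<le> S (Suc k)"
        "real n \<le> (S (Suc k) - w) / \<gamma> + L"
        using newton[OF _ Suc.prems W'(1,2)] by auto
      have "memip a b \<epsilon> \<alpha> d H W1 (Suc k) = Some (Xs @ [X], N + n)"
        using Suc.hyps IH(1) W'(3) X(1) by (simp add: W_def F_def)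
      moreover have "(Xs @ [X]) ! (j - 1) \<in> rspace (param_idx d j) \<and>
          (\<exists>y. F j ((Xs @ [X]) ! (j - 1)) = ereal y \<and> S j - \<epsilon> \<le> y \<and> y \<le> S j)"
        if "j \<in> {1..Suc k}" for j
      proof (cases "j = Suc k")
        case True
        then show ?thesis using X IH(2) by (simp add: nth_append)
      next
        case False
        then have "j \<in> {1..k}" using that by auto
        then show ?thesis using IH(2) IH(3)[of j] by (auto simp: nth_append)
      qed
      moreover have "real (N + n) \<le> (S (Suc k) - w1) / \<gamma> + real (Suc k) * (L + 1 / \<gamma> * \<epsilon>)"
      proof -
        have "(S k - w) / \<gamma> \<le> \<epsilon> / \<gamma>"
          using W(3) \<gamma> by (intro divide_right_mono) auto
        then show ?thesis
          using IH(4) X(4) by (simp add: algebra_simps diff_divide_distrib)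
      qed
      ultimately show ?case
        using IH(2) by (intro exI[of _ "Xs @ [X]"] exI[of _ "N + n"]) auto
    qed
    from main[OF K order_refl] obtain Xs N where
      res: "memip a b \<epsilon> \<alpha> d H W1 K = Some (Xs, N)" "length Xs = K"
        "\<And>j. j \<in> {1..K} \<Longrightarrow> Xs ! (j - 1) \<in> rspace (param_idx d j) \<and>
          (\<exists>y. F j (Xs ! (j - 1)) = ereal y \<and> S j - \<epsilon> \<le> y \<and> y \<le> S j)"
        "real N \<le> (S K - w1) / \<gamma> + real K * (L + 1 / \<gamma> * \<epsilon>)"
      by auto
    have "\<bar>loglik \<alpha> d H k (Xs ! (k - 1)) - sup_loglik \<alpha> d H k\<bar> \<le> ereal \<epsilon>" if "k \<in> {1..K}" for k
      using res(3)[OF that] S[of k] that by (auto simp: F_def)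
    moreover have "ereal (real N) \<le> ereal (1 / \<gamma>) * (sup_loglik \<alpha> d H K - loglik \<alpha> d H 1 W1) +
        ereal (real K * (log 2 (log 2 (1 / \<epsilon>)) + 1 / \<gamma> * \<epsilon>))"
      using res(4) S[OF K order_refl] w1 by (simp add: F_def L_def)
    ultimately show "\<exists>Xs N. memip a b \<epsilon> \<alpha> d H W1 K = Some (Xs, N) \<and> length Xs = K \<and>
          (\<forall>k\<in>{1..K}. Xs ! (k - 1) \<in> rspace (param_idx d k) \<and>
             \<bar>loglik \<alpha> d H k (Xs ! (k - 1)) - sup_loglik \<alpha> d H k\<bar> \<le> ereal \<epsilon>) \<and>
          ereal (real N) \<le>
            ereal (1 / \<gamma>) * (sup_loglik \<alpha> d H K - loglik \<alpha> d H 1 W1) +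
            ereal (real K * (log 2 (log 2 (1 / \<epsilon>)) + 1 / \<gamma> * \<epsilon>))"
      using res by blast
  qed
qed

end
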